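(* Let $X$ be a nonempty set, let $\Sigma \subseteq \mathcal{P}(X)$ be a nonempty set of subsets of $X$, and let $T : X \longrightarrow X$ be an arbitrary mapping. Let $(\Lambda, \leq)$ be a directed partially ordered set, together with a mapping $\Lambda \ni \lambda \longmapsto \Delta_\lambda \in \mathcal{FP}(X, \Sigma)$ such that for all $\lambda, \lambda' \in \Lambda$, $\lambda \leq \lambda'$ implies $\Delta_\lambda \leq \Delta_{\lambda'}$. Suppose that there exists a subset $\Lambda_0 \subseteq \Lambda$ which is countable and cofinal in $\Lambda$. Then for every $x \in X$, $$\varprojlim_{\lambda \in \Lambda} \Delta_\lambda(x) \neq \emptyset .$$
   Context: $\mathbb{N}_+ = \{1,2,3,\ldots\}$, and $T^n$ denotes the $n$-th iterate of $T$. $\mathcal{P}(X)$ is the set of all subsets of $X$. $\mathcal{FP}(X,\Sigma)$ denotes the set of all finite partitions $\Delta$ of $X$ into nonempty subsets belonging to $\Sigma$; that is, $\Delta \subseteq \Sigma$ is finite, its members are nonempty and pairwise disjoint, and $X = \bigcup_{A \in \Delta} A$. For $x \in X$ and $\Delta \in \mathcal{FP}(X,\Sigma)$, define $$\Delta(x) = \{ A \in \Delta \mid \{ n \in \mathbb{N}_+ \mid T^n(x) \in A \} \text{ is infinite} \}.$$ In particular $\Delta_\lambda(x)$ is this set for $\Delta = \Delta_\lambda$. Refinement: for $\Delta, \Delta' \in \mathcal{FP}(X,\Sigma)$, $\Delta \leq \Delta'$ means that for every $A' \in \Delta'$ there exists $A \in \Delta$ with $A' \subseteq A$. In that case $\psi_{\Delta',\Delta}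 : \Delta' \longrightarrow \Delta$ is the mapping sending $A' \in \Delta'$ to the (unique) $A \in \Delta$ with $A' \subseteq A$. For $\lambda \leq \lambda'$ in $\Lambda$ and $x \in X$, $\psi_{\lambda',\lambda,x} : \Delta_{\lambda'}(x) \longrightarrow \Delta_\lambda(x)$ is the restriction of $\psi_{\Delta_{\lambda'},\Delta_\lambda}$ to $\Delta_{\lambda'}(x)$ (it takes values in $\Delta_\lambda(x)$). The inverse limit is $$\varprojlim_{\lambda \in \Lambda} \Delta_\lambda(x) = \Big\{ (A_\lambda)_{\lambda \in \Lambda} \in \prod_{\lambda \in \Lambda} \Delta_\lambda(x) \ \Big|\ \psi_{\lambda',\lambda,x}(A_{\lambda'}) = A_\lambda \text{ for all } \lambda, \lambda' \in \Lambda \text{ with } \lambda \leq \lambda' \Big\}.$$ A subset $\Lambda_0 \subseteq \Lambda$ is cofinal if for every $\lambda \in \Lambda$ there is $\lambda_0 \in \Lambda_0$ with $\lambda \leq \lambda_0$. *)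

theory Defs
  imports Main "HOL-Library.FuncSet" "HOL-Library.Disjoint_Sets" "HOL-Library.Countable_Set"
begin

definition finite_partitions :: "'a set \<Rightarrow> 'a set set \<Rightarrow> 'a set set set" where
  "finite_partitions X \<Sigma> = {\<Delta>. finite \<Delta> \<and> \<Delta> \<subseteq> \<Sigma> \<and> partition_on X \<Delta>}"

definition recurrent_cells :: "('a \<Rightarrow> 'a) \<Rightarrow> 'a \<Rightarrow> 'a set set \<Rightarrow> 'a set set" where
  "recurrent_cells T x \<Delta> = {A \<in> \<Delta>. infinite {n::nat. n \<ge> 1 \<and> (T ^^ n) x \<in> A}}"

text \<open>The map \<open>\<psi>\<close> from the finer partition \<open>\<Delta>'\<close> to the coarser \<open>\<Delta>\<close>.\<close>

definition coarsening_map :: "'a set set \<Rightarrow> 'a set set \<Rightarrow> 'a set \<Rightarrow> 'a set" where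
  "coarsening_map \<Delta>' \<Delta> = (\<lambda>A'\<in>\<Delta>'. THE A. A \<in> \<Delta> \<and> A' \<subseteq> A)"

definition recurrent_coarsening_map ::
    "('a \<Rightarrow> 'a) \<Rightarrow> 'a \<Rightarrow> 'a set set \<Rightarrow> 'a set set \<Rightarrow> 'a set \<Rightarrow> 'a set" where
  "recurrent_coarsening_map T x \<Delta>' \<Delta> =
     restrict (coarsening_map \<Delta>' \<Delta>) (recurrent_cells T x \<Delta>')"

text \<open>An order on the carrier \<open>\<Lambda>\<close> is a relation \<open>r\<close>, where \<open>(l, l') \<in> r\<close> means \<open>l \<le> l'\<close>.
  The empty poset is not excluded here; the inverse limit below is then a singleton.\<close>

definition directed_poset :: "'i set \<Rightarrow> 'i rel \<Rightarrow> bool" where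
  "directed_poset \<Lambda> r \<longleftrightarrow> partial_order_on \<Lambda> r \<and>
     (\<forall>l\<in>\<Lambda>. \<forall>l'\<in>\<Lambda>. \<exists>u\<in>\<Lambda>. (l, u) \<in> r \<and> (l', u) \<in> r)"

text \<open>The library constant \<open>cofinal\<close> asks for strict upper bounds, so it is not used here.\<close>

definition cofinal_subset :: "'i set \<Rightarrow> 'i set \<Rightarrow> 'i rel \<Rightarrow> bool" where
  "cofinal_subset \<Lambda>0 \<Lambda> r \<longleftrightarrow> \<Lambda>0 \<subseteq> \<Lambda> \<and> (\<forall>l\<in>\<Lambda>. \<exists>l0\<in>\<Lambda>0. (l, l0) \<in> r)"

text \<open>The transition map for \<open>l \<le> l'\<close> is \<open>f l' l\<close>, from \<open>E l'\<close> to \<open>E l\<close>.\<close>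

definition inverse_limit ::
    "'i set \<Rightarrow> 'i rel \<Rightarrow> ('i \<Rightarrow> 'b set) \<Rightarrow> ('i \<Rightarrow> 'i \<Rightarrow> 'b \<Rightarrow> 'b) \<Rightarrow> ('i \<Rightarrow> 'b) set" where
  "inverse_limit \<Lambda> r E f =
     {a \<in> Pi\<^sub>E \<Lambda> E. \<forall>l\<in>\<Lambda>. \<forall>l'\<in>\<Lambda>. (l, l') \<in> r \<longrightarrow> f l' l (a l') = a l}"

end

theory Submission
  imports Defs
begin

text \<open>For a single finite partition the pigeonhole principle gives a cell that the orbit of \<open>x\<close>
  enters infinitely often; the point is to choose such cells compatibly for all partitions.
  Countability allows this to be done by successive thinning.  Enumerate the partitions \<open>\<Delta> l0\<close> with
  \<open>l0\<close> in the countable cofinal subset, start with \<open>X\<close>, and at each step intersect the current set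
  with a cell of the next partition so that the orbit still enters the intersection infinitely
  often (\<open>infinite_visits_in_some_cell\<close>).  This gives a decreasing sequence of sets \<open>C k\<close>, all
  entered infinitely often (\<open>thinning_sequence\<close>).

  Call a cell of \<open>\<Delta> l\<close> selected when it contains some \<open>C k\<close>.  Each \<open>\<Delta> l\<close> has a selected cell: by
  cofinality it is refined by some \<open>\<Delta> l0\<close> of the enumeration, and the cell of \<open>\<Delta> l0\<close> used for the
  thinning lies in a cell of \<open>\<Delta> l\<close>.  It has only one, because any two of the \<open>C k\<close> are nested and
  nonempty whereas distinct cells are disjoint.  A selected cell is recurrent since it contains a
  set entered infinitely often, and a cell of a coarser partition that contains a selected cell is
  itself selected.  Hence the selected cells form an element of the inverse limit.\<close>

lemma infinite_visits_in_some_cell: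
  fixes u :: "nat \<Rightarrow> 'a"
  assumes "finite P" "partition_on X P" "C \<subseteq> X" "infinite {n \<in> N. u n \<in> C}"
  obtains A where "A \<in> P" "infinite {n \<in> N. u n \<in> C \<inter> A}"
proof -
  have "{n \<in> N. u n \<in> C} \<subseteq> (\<Union>A\<in>P. {n \<in> N. u n \<in> C \<inter> A})"
    using assms(3) partition_onD1[OF assms(2)] by blast
  then have "infinite (\<Union>A\<in>P. {n \<in> N. u n \<in> C \<inter> A})"
    using assms(4) finite_subset by blast
  then show thesis
    using that \<open>finite P\<close> by blast
qed

text \<open>A countable substitute for an ultrafilter: the sets \<open>C k\<close> generate a filter that decides
  every partition in \<open>D\<close> and whose members are all entered infinitely often.\<close>

lemma thinning_sequence:
  fixes u :: "nat \<Rightarrow> 'a"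
  assumes "countable D"
    and D: "\<forall>P\<in>D. finite P \<and> partition_on X P"
    and "infinite N" "u ` N \<subseteq> X"
  obtains C :: "nat \<Rightarrow> 'a set" where "antimono C" "\<And>k. infinite {n \<in> N. u n \<in> C k}"
    "\<And>P. P \<in> D \<Longrightarrow> \<exists>k. \<exists>A\<in>P. C k \<subseteq> A"
proof -
  let ?visited = "\<lambda>C. C \<subseteq> X \<and> infinite {n \<in> N. u n \<in> C}"
  \<comment> \<open>For empty \<open>D\<close> the enumeration yields a value outside \<open>D\<close>; the premise below discards it.\<close>
  let ?thins = "\<lambda>k C C'. C' \<subseteq> C \<and>
      (from_nat_into D k \<in> D \<longrightarrow> (\<exists>A\<in>from_nat_into D k. C' \<subseteq> A))"
  have "{n \<in> N. u n \<in> X} = N"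
    using assms(4) by auto
  then have start: "?visited X"
    using assms(3) by simp
  have step: "\<exists>C'. ?visited C' \<and> ?thins k C C'" if C: "?visited C" for C k
  proof (cases "from_nat_into D k \<in> D")
    case True
    then obtain A where "A \<in> from_nat_into D k" "infinite {n \<in> N. u n \<in> C \<inter> A}"
      using infinite_visits_in_some_cell[of "from_nat_into D k" X C N u] D C by blast
    then show ?thesis
      using C by (intro exI[of _ "C \<inter> A"]) auto
  next
    case False
    then show ?thesis
      using C by auto
  qed
  have "\<exists>C. \<forall>k. ?visited (C k) \<and> ?thins k (C k) (C (Suc k))"
  proof (rule dependent_nat_choice[of "\<lambda>_. ?visited" ?thins])
    show "\<exists>C. ?visited C"
      using start by (rule exI)
  qed (rule step)
  then obtain C where "\<forall>k. ?visited (C k) \<and> ?thins k (C k) (C (Suc k))" ..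
  then have C: "\<And>k. ?visited (C k)" "\<And>k. ?thins k (C k) (C (Suc k))"
    by simp_all
  show thesis
  proof (rule that)
    show "antimono C"
      using C(2) by (simp add: antimono_iff_le_Suc)
    show "infinite {n \<in> N. u n \<in> C k}" for k
      using C(1) by blast
    show "\<exists>k. \<exists>A\<in>P. C k \<subseteq> A" if "P \<in> D" for P
      using from_nat_into_surj[OF assms(1) that] C(2) that by metis
  qed
qed

lemma coarsening_map_eqI:
  assumes "partition_on X P'" "partition_on X P" "A' \<in> P'" "A \<in> P" "A' \<subseteq> A"
  shows "coarsening_map P' P A' = A"
proof -
  have "A' \<noteq> {}"
    using assms(1,3) partition_onD3 by blast
  then have unique: "B = A" if "B \<in> P" "A' \<subseteq> B" for B
    using that assms(4,5) partition_onD2[OF assms(2)] unfolding disjoint_def by blast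
  have "(THE A. A \<in> P \<and> A' \<subseteq> A) = A"
    using assms(4,5) by (auto intro!: the_equality dest: unique)
  then show ?thesis
    using assms(3) by (simp add: coarsening_map_def)
qed

theorem theorem1:
  fixes X :: "'a set" and \<Sigma> :: "'a set set" and T :: "'a \<Rightarrow> 'a"
    and \<Lambda> :: "'i set" and r :: "'i rel" and \<Delta> :: "'i \<Rightarrow> 'a set set"
  assumes "X \<noteq> {}"
    and "\<Sigma> \<subseteq> Pow X" and "\<Sigma> \<noteq> {}"
    and "T \<in> X \<rightarrow> X"
    and "directed_poset \<Lambda> r"
    and "\<Delta> \<in> \<Lambda> \<rightarrow> finite_partitions X \<Sigma>"
    and "\<And>l l'. l \<in> \<Lambda> \<Longrightarrow> l' \<in> \<Lambda> \<Longrightarrow> (l, l') \<in> r \<Longrightarrow> refines X (\<Delta> l') (\<Delta> l)"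
    and "\<exists>\<Lambda>0. countable \<Lambda>0 \<and> cofinal_subset \<Lambda>0 \<Lambda> r"
  shows "\<forall>x\<in>X. inverse_limit \<Lambda> r (\<lambda>l. recurrent_cells T x (\<Delta> l))
           (\<lambda>l' l. recurrent_coarsening_map T x (\<Delta> l') (\<Delta> l)) \<noteq> {}"
proof
  fix x assume "x \<in> X"
  obtain \<Lambda>0 where "countable \<Lambda>0" and cofinal: "cofinal_subset \<Lambda>0 \<Lambda> r"
    using assms(8) by blast
  have part: "finite (\<Delta> l)" "partition_on X (\<Delta> l)" if "l \<in> \<Lambda>" for l
    using assms(6) that by (auto simp: finite_partitions_def)

  let ?N = "{n::nat. n \<ge> 1}" and ?u = "\<lambda>n. (T ^^ n) x"
  have countable: "countable (\<Delta> ` \<Lambda>0)"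
    using \<open>countable \<Lambda>0\<close> by simp
  have partitions: "\<forall>P\<in>\<Delta> ` \<Lambda>0. finite P \<and> partition_on X P"
    using part cofinal by (auto simp: cofinal_subset_def)
  have times: "infinite ?N"
    using infinite_Ici[of "1::nat"] by (simp add: atLeast_def)
  have "?u n \<in> X" for n
    using \<open>x \<in> X\<close> assms(4) by (induction n) auto
  then have orbit: "?u ` ?N \<subseteq> X"
    by blast
  obtain C :: "nat \<Rightarrow> 'a set" where "antimono C"
    and visits: "\<And>k. infinite {n \<in> ?N. ?u n \<in> C k}"
    and decides: "\<And>P. P \<in> \<Delta> ` \<Lambda>0 \<Longrightarrow> \<exists>k. \<exists>A\<in>P. C k \<subseteq> A"
    using thinning_sequence[OF countable partitions times orbit] by blast

  let ?selected = "\<lambda>l A. A \<in> \<Delta> l \<and> (\<exists>k. C k \<subseteq> A)"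
  have selected_ex: "\<exists>A. ?selected l A" if l: "l \<in> \<Lambda>" for l
  proof -
    obtain l0 where l0: "l0 \<in> \<Lambda>0" "l0 \<in> \<Lambda>" "(l, l0) \<in> r"
      using cofinal l unfolding cofinal_subset_def by blast
    obtain k A0 where A0: "A0 \<in> \<Delta> l0" "C k \<subseteq> A0"
      using decides[OF imageI[OF l0(1)]] by auto
    obtain A where "A \<in> \<Delta> l" "A0 \<subseteq> A"
      using assms(7)[OF l l0(2,3)] A0(1) unfolding refines_def by blast
    then show ?thesis
      using A0(2) by (meson order_trans)
  qed
  have selected_unique: "A = B" if l: "l \<in> \<Lambda>" and AB: "?selected l A" "?selected l B" for l A B
  proof -
    obtain j k where "C j \<subseteq> A" "C k \<subseteq> B"
      using AB by blast
    then have "C (max j k) \<subseteq> A \<inter> B"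
      using antimonoD[OF \<open>antimono C\<close>, of j "max j k"]
        antimonoD[OF \<open>antimono C\<close>, of k "max j k"] by auto
    moreover have "C (max j k) \<noteq> {}"
      using visits[of "max j k"] by auto
    ultimately show ?thesis
      using AB partition_onD2[OF part(2)[OF l]] unfolding disjoint_def by blast
  qed
  have selected_recurrent: "A \<in> recurrent_cells T x (\<Delta> l)" if A: "?selected l A" for l A
  proof -
    obtain k where "C k \<subseteq> A"
      using A by blast
    then have "{n \<in> ?N. ?u n \<in> C k} \<subseteq> {n. n \<ge> 1 \<and> ?u n \<in> A}"
      by auto
    then show ?thesis
      using visits[of k] A finite_subset unfolding recurrent_cells_def by blast
  qed

  define a where "a = (\<lambda>l\<in>\<Lambda>. SOME A. ?selected l A)"
  have a: "?selected l (a l)" if "l \<in> \<Lambda>" for l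
    using someI_ex[OF selected_ex[OF that]] that by (simp add: a_def)
  have "a \<in> inverse_limit \<Lambda> r (\<lambda>l. recurrent_cells T x (\<Delta> l))
           (\<lambda>l' l. recurrent_coarsening_map T x (\<Delta> l') (\<Delta> l))"
    unfolding inverse_limit_def
  proof (intro CollectI conjI ballI impI)
    show "a \<in> (\<Pi>\<^sub>E l\<in>\<Lambda>. recurrent_cells T x (\<Delta> l))"
      using selected_recurrent[OF a] by (intro PiE_I) (auto simp: a_def)
  next
    fix l l' assume l: "l \<in> \<Lambda>" "l' \<in> \<Lambda>" "(l, l') \<in> r"
    obtain A where A: "A \<in> \<Delta> l" "a l' \<subseteq> A"
      using assms(7)[OF l] a[OF l(2)] unfolding refines_def by blast
    then have "?selected l A"
      using a[OF l(2)] by blast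
    then have "A = a l"
      using selected_unique[OF l(1) _ a[OF l(1)]] by blast
    then have "a l' \<subseteq> a l"
      using A by simp
    then have "coarsening_map (\<Delta> l') (\<Delta> l) (a l') = a l"
      using coarsening_map_eqI[OF part(2)[OF l(2)] part(2)[OF l(1)]] a[OF l(2)] a[OF l(1)] by simp
    then show "recurrent_coarsening_map T x (\<Delta> l') (\<Delta> l) (a l') = a l"
      using selected_recurrent[OF a[OF l(2)]] by (simp add: recurrent_coarsening_map_def)
  qed
  then show "inverse_limit \<Lambda> r (\<lambda>l. recurrent_cells T x (\<Delta> l))
           (\<lambda>l' l. recurrent_coarsening_map T x (\<Delta> l') (\<Delta> l)) \<noteq> {}"
    by blast
qed

end
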